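(* Let $\mathcal{X}$ be a finite set and let $\{P_\theta\mid\theta\in\Theta\}$ be a non-empty family of probability distributions on $\mathcal{X}$. Then for any $\alpha\in[0,\infty]$ the channel capacity equals the minimax redundancy: $$C_\alpha=R_\alpha,$$ where $$C_\alpha=\sup_{\pi}\inf_{Q}\int D_\alpha(P_\theta\|Q)\,d\pi(\theta),\qquad R_\alpha=\inf_Q\sup_{\theta\in\Theta}D_\alpha(P_\theta\|Q),$$ with $\pi$ ranging over all probability distributions on $\Theta$ and $Q$ over all probability distributions on $\mathcal{X}$.
   Context: Standing assumptions: $\Theta$ is a topological space equipped with its Borel $\sigma$-algebra, $\{\theta\}$ is a closed set for every $\theta\in\Theta$, and the map $\theta\mapsto P_\theta$ is measurable. Rényi divergence on a finite set: for $\alpha\in(0,1)\cup(1,\infty)$, $D_\alpha(P\|Q)=\frac{1}{\alpha-1}\ln\sum_x P(x)^\alpha Q(x)^{1-\alpha}\in[0,\infty]$, where for $\alpha>1$ one reads $P(x)^\alpha Q(x)^{1-\alpha}$ as $P(x)^\alpha/Q(x)^{\alpha-1}$ with the conventions $0/0=0$ and $y/0=\infty$ for $y>0$. Further $D_0(P\|Q)=\lim_{\alpha\downarrow0}D_\alpha(P\|Q)$, $D_1(P\|Q)=\lim_{\alpha\uparrow1}D_\alpha(P\|Q)$ (the Kullback-Leibler divergence) and $D_\infty(P\|Q)=\lim_{\alpha\uparrow\infty}D_\alpha(P\|Q)$ (these limits always exist in $[0,\infty]$). *)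

theory Defs
  imports "HOL-Probability.Probability"
begin

definition ln_ennreal :: "ennreal \<Rightarrow> ereal" where
  "ln_ennreal x = (if x = 0 then -\<infinity> else if x = \<top> then \<infinity> else ereal (ln (enn2real x)))"

text \<open>Division in \<^typ>\<open>ennreal\<close> satisfies 0 / 0 = 0 and y / 0 = \<open>\<infinity>\<close> for y > 0, which is the
  convention required for orders above 1.\<close>

definition renyi_sum :: "real \<Rightarrow> 'x::finite pmf \<Rightarrow> 'x pmf \<Rightarrow> ennreal" where
  "renyi_sum a P Q =
     (\<Sum>x\<in>UNIV. if a < 1 then ennreal (pmf P x powr a * pmf Q x powr (1 - a))
                else ennreal (pmf P x powr a) / ennreal (pmf Q x powr (a - 1)))"

text \<open>Meaningful for orders in (0,1) and above 1. There the argument of \<^const>\<open>e2ennreal\<close> is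
  nonnegative (lemma \<open>renyi_div_simple_nonneg\<close>), so nothing is truncated.\<close>

definition renyi_div_simple :: "real \<Rightarrow> 'x::finite pmf \<Rightarrow> 'x pmf \<Rightarrow> ennreal" where
  "renyi_div_simple a P Q = e2ennreal (ereal (1 / (a - 1)) * ln_ennreal (renyi_sum a P Q))"

definition renyi_div :: "ennreal \<Rightarrow> 'x::finite pmf \<Rightarrow> 'x pmf \<Rightarrow> ennreal" where
  "renyi_div \<alpha> P Q =
     (if \<alpha> = 0 then Lim (at_right 0) (\<lambda>a. renyi_div_simple a P Q)
      else if \<alpha> = 1 then Lim (at_left 1) (\<lambda>a. renyi_div_simple a P Q)
      else if \<alpha> = \<top> then Lim at_top (\<lambda>a. renyi_div_simple a P Q)
      else renyi_div_simple (enn2real \<alpha>) P Q)"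

definition channel_capacity ::
    "ennreal \<Rightarrow> ('t::topological_space \<Rightarrow> 'x::finite pmf) \<Rightarrow> ennreal" where
  "channel_capacity \<alpha> P =
     (SUP \<pi>\<in>{\<pi>. prob_space \<pi> \<and> sets \<pi> = sets borel}. INF Q. \<integral>\<^sup>+\<theta>. renyi_div \<alpha> (P \<theta>) Q \<partial>\<pi>)"

definition minimax_redundancy :: "ennreal \<Rightarrow> ('t \<Rightarrow> 'x::finite pmf) \<Rightarrow> ennreal" where
  "minimax_redundancy \<alpha> P = (INF Q. SUP \<theta>. renyi_div \<alpha> (P \<theta>) Q)"

lemma young_powr:
  fixes p q a :: real
  assumes "p \<ge> 0" "q \<ge> 0" "0 < a" "a < 1"
  shows "p powr a * q powr (1 - a) \<le> a * p + (1 - a) * q"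
proof (cases "p = 0 \<or> q = 0")
  case True
  then show ?thesis using assms by auto
next
  case False
  then have pq: "p > 0" "q > 0" using assms by auto
  have "exp ((1 - a) *\<^sub>R ln q + a *\<^sub>R ln p) \<le> (1 - a) * exp (ln q) + a * exp (ln p)"
    by (rule convex_onD[OF exp_convex]) (use assms in auto)
  then show ?thesis using pq by (simp add: powr_def exp_add mult.commute add.commute)
qed

lemma sum_pmf_UNIV: "(\<Sum>x\<in>UNIV. pmf P x) = 1" for P :: "'x::finite pmf"
  by (rule sum_pmf_eq_1) auto

lemma renyi_sum_le_1:
  assumes "0 < a" "a < 1"
  shows "renyi_sum a P Q \<le> 1"
proof -
  have "renyi_sum a P Q = ennreal (\<Sum>x\<in>UNIV. pmf P x powr a * pmf Q x powr (1 - a))"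
    using assms by (simp add: renyi_sum_def)
  also have "\<dots> \<le> ennreal (\<Sum>x\<in>UNIV. a * pmf P x + (1 - a) * pmf Q x)"
    by (intro ennreal_leI sum_mono young_powr) (use assms in auto)
  also have "(\<Sum>x\<in>UNIV. a * pmf P x + (1 - a) * pmf Q x) = 1"
    by (simp add: sum.distrib sum_distrib_left[symmetric] sum_pmf_UNIV)
  finally show ?thesis by simp
qed

lemma renyi_sum_ge_1:
  assumes "1 < a"
  shows "1 \<le> renyi_sum a P Q"
proof -
  have *: "ennreal (a * pmf P x + (1 - a) * pmf Q x)
      \<le> ennreal (pmf P x powr a) / ennreal (pmf Q x powr (a - 1))" for x
  proof (cases "pmf Q x = 0")
    case True
    then show ?thesis
      by (cases "pmf P x = 0") (auto simp: ennreal_divide_zero pmf_nonneg ennreal_divide_eq_top_iff)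
  next
    case False
    define p q where "p = pmf P x" and "q = pmf Q x"
    have q: "q > 0" and p: "p \<ge> 0"
      using False by (auto simp: p_def q_def pmf_nonneg order_less_le)
    define t where "t = p powr a / q powr (a - 1)"
    have "t powr (1 / a) * q powr (1 - 1 / a) \<le> 1 / a * t + (1 - 1 / a) * q"
      by (rule young_powr) (use assms p q in \<open>auto simp: t_def\<close>)
    moreover have "t powr (1 / a) * q powr (1 - 1 / a) = p"
      using assms p q
      by (simp add: t_def powr_divide powr_powr diff_divide_distrib)
    ultimately have "a * p \<le> a * (1 / a * t + (1 - 1 / a) * q)"
      using assms by (intro mult_left_mono) auto
    also have "\<dots> = t + (a - 1) * q" using assms by (simp add: field_simps)
    finally have "a * p + (1 - a) * q \<le> t" by (simp add: algebra_simps)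
    then show ?thesis
      using q unfolding t_def p_def q_def by (subst divide_ennreal) (auto intro: ennreal_leI)
  qed
  have "1 = ennreal (\<Sum>x\<in>UNIV. a * pmf P x + (1 - a) * pmf Q x)"
    by (simp add: sum.distrib sum_distrib_left[symmetric] sum_pmf_UNIV)
  also have "\<dots> \<le> ennreal (\<Sum>x\<in>UNIV. max 0 (a * pmf P x + (1 - a) * pmf Q x))"
    by (intro ennreal_leI sum_mono) auto
  also have "\<dots> = (\<Sum>x\<in>UNIV. ennreal (max 0 (a * pmf P x + (1 - a) * pmf Q x)))"
    by (subst sum_ennreal) auto
  also have "\<dots> \<le> renyi_sum a P Q"
    unfolding renyi_sum_def using assms *
    by (intro sum_mono) (auto simp: max_def)
  finally show ?thesis .
qed

lemma renyi_div_simple_nonneg: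
  assumes "0 < a" "a \<noteq> 1"
  shows "0 \<le> ereal (1 / (a - 1)) * ln_ennreal (renyi_sum a P Q)"
proof (cases "a < 1")
  case True
  then have "renyi_sum a P Q \<le> 1" using assms renyi_sum_le_1 by auto
  then have "ln_ennreal (renyi_sum a P Q) \<le> 0"
    by (cases "renyi_sum a P Q") (auto simp: ln_ennreal_def top_unique)
  moreover have "ereal (1 / (a - 1)) \<le> 0" using True by simp
  ultimately show ?thesis by (simp add: ereal_zero_le_0_iff)
next
  case False
  then have "1 \<le> renyi_sum a P Q" using assms by (intro renyi_sum_ge_1) auto
  then have "0 \<le> ln_ennreal (renyi_sum a P Q)"
    by (cases "renyi_sum a P Q") (auto simp: ln_ennreal_def)
  moreover have "0 \<le> ereal (1 / (a - 1))" using False by simp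
  ultimately show ?thesis by (simp add: ereal_zero_le_0_iff)
qed

end

(* Weak duality is immediate. For the converse let s be below the minimax redundancy. The divergence
   is convex and lower semicontinuous in Q on the compact probability simplex, so finitely many
   parameters already force the maximal divergence above s for every Q. Separating convex sets
   in the plane, one parameter at a time, yields weights on these parameters whose averaged
   divergence is at least s for every Q, that is, a finitely supported prior. Infinite values are
   handled by mixing these weights with the uniform ones. *)

theory Submission
  imports Defs
begin

section \<open>Minimax for convex functions\<close>

text \<open>Passing to finitely many parameters keeps the prior a finite weight vector, so no
  topology on the set of priors enters, and closed points let the weights be realised as a Borel
  measure. The obstacle is the value \<open>\<top>\<close>: since \<open>0 * \<top> = 0\<close>,
  weights found where all divergences are finite may vanish exactly on a parameter whose divergence
  is infinite elsewhere. A uniform share makes every weight positive, and its price is paid from a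
  strict gap \<open>s < r\<close>. Convexity in \<open>Q\<close> has different causes on the two
  sides of order 1. Below 1 the power sum is concave in \<open>Q\<close>, hence so is its logarithm,
  and the negative factor \<open>1 / (a - 1)\<close> turns this around. Above 1 convexity of the sum
  would not survive the logarithm; the sum has to be log-convex. These facts and monotonicity in the
  order all rest on weighted AM-GM (\<open>young_powr\<close>); the Hoelder-type estimates apply it
  to terms normalised by their sums.\<close>

text \<open>A line separates the pairs lying above some \<open>(f v, g v)\<close> from the open
  quadrant below \<open>(r, r)\<close>; its normal vector, scaled to sum 1, gives the
  weights.\<close>

lemma two_function_minimax:
  fixes f g :: "'v::real_vector \<Rightarrow> real"
  assumes f: "convex_on K f" and g: "convex_on K g"
    and ge: "\<And>v. v \<in> K \<Longrightarrow> r \<le> f v \<or> r \<le> g v"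
  obtains c where "0 \<le> c" "c \<le> 1" "\<And>v. v \<in> K \<Longrightarrow> r \<le> c * f v + (1 - c) * g v"
proof (cases "K = {}")
  case True
  then show thesis
    using that[of 0] by simp
next
  case False
  \<comment> \<open>The image of \<open>K\<close> under \<open>(f, g)\<close> need not be convex;
    its upward closure is.\<close>
  define S where "S = {(x, y). \<exists>v\<in>K. f v \<le> x \<and> g v \<le> y}"
  have "convex K"
    using f by (rule convex_on_imp_convex)
  have S: "convex S"
  proof (rule convexI)
    fix p q :: "real \<times> real" and u w :: real
    assume "p \<in> S" "q \<in> S" and uw: "0 \<le> u" "0 \<le> w" "u + w = 1"
    then obtain a b where ab: "a \<in> K" "b \<in> K" "f a \<le> fst p" "g a \<le> snd p" "f b \<le> fst q" "g b \<le> snd q"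
      unfolding S_def by auto
    have "u *\<^sub>R a + w *\<^sub>R b \<in> K"
      using \<open>convex K\<close> ab uw by (auto simp: convex_def)
    moreover have "f (u *\<^sub>R a + w *\<^sub>R b) \<le> u * fst p + w * fst q"
    proof -
      have "f (u *\<^sub>R a + w *\<^sub>R b) \<le> u * f a + w * f b"
        using f ab uw by (auto simp: convex_on_def)
      also have "\<dots> \<le> u * fst p + w * fst q"
        using ab uw by (intro add_mono mult_left_mono) auto
      finally show ?thesis .
    qed
    moreover have "g (u *\<^sub>R a + w *\<^sub>R b) \<le> u * snd p + w * snd q"
    proof -
      have "g (u *\<^sub>R a + w *\<^sub>R b) \<le> u * g a + w * g b"
        using g ab uw by (auto simp: convex_on_def)
      also have "\<dots> \<le> u * snd p + w * snd q"
        using ab uw by (intro add_mono mult_left_mono) auto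
      finally show ?thesis .
    qed
    ultimately show "u *\<^sub>R p + w *\<^sub>R q \<in> S"
      unfolding S_def by (cases p; cases q) auto
  qed
  have "convex ({..<r} \<times> {..<r})"
    by (intro convex_Times convex_real_interval)
  moreover have "S \<noteq> {}"
    using False by (auto simp: S_def)
  moreover have "{..<r} \<times> {..<r} \<noteq> {}"
    by auto
  moreover have "({..<r} \<times> {..<r}) \<inter> S = {}"
    using ge by (fastforce simp: S_def)
  ultimately obtain ab c where ne: "ab \<noteq> 0"
    and le: "\<forall>p\<in>{..<r} \<times> {..<r}. ab \<bullet> p \<le> c" and ge': "\<forall>p\<in>S. c \<le> ab \<bullet> p"
    using separating_hyperplane_sets[of "{..<r} \<times> {..<r}" S] S by blast
  obtain a b where ab: "ab = (a, b)"
    by (cases ab)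
  have le: "a * x + b * y \<le> c" if "x < r" "y < r" for x y
    using le that by (auto simp: ab inner_prod_def)
  have ge': "c \<le> a * f v + b * g v" if "v \<in> K" for v
    using ge' that by (auto simp: ab inner_prod_def S_def)
  obtain v0 where v0: "v0 \<in> K"
    using False by auto
  have a: "0 \<le> a"
  proof (rule ccontr)
    assume "\<not> 0 \<le> a"
    \<comment> \<open>This \<open>x\<close> stays in the quadrant, while a negative \<open>a\<close>
      makes \<open>a * x\<close> at least \<open>c - b * (r - 1) + 1\<close>, one more than the
      separation permits.\<close>
    define x where "x = min (r - 1) ((c - b * (r - 1) + 1) / a)"
    have "a * ((c - b * (r - 1) + 1) / a) \<le> a * x"
      using \<open>\<not> 0 \<le> a\<close> by (intro mult_left_mono_neg) (auto simp: x_def)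
    moreover have "a * x + b * (r - 1) \<le> c"
      by (rule le) (auto simp: x_def)
    ultimately show False
      using \<open>\<not> 0 \<le> a\<close> by simp
  qed
  have b: "0 \<le> b"
  proof (rule ccontr)
    assume "\<not> 0 \<le> b"
    define x where "x = min (r - 1) ((c - a * (r - 1) + 1) / b)"
    have "b * ((c - a * (r - 1) + 1) / b) \<le> b * x"
      using \<open>\<not> 0 \<le> b\<close> by (intro mult_left_mono_neg) (auto simp: x_def)
    moreover have "a * (r - 1) + b * x \<le> c"
      by (rule le) (auto simp: x_def)
    ultimately show False
      using \<open>\<not> 0 \<le> b\<close> by simp
  qed
  have ab_pos: "0 < a + b"
    using a b ne ab by (auto simp: zero_prod_def order_less_le)
  \<comment> \<open>The open quadrant omits its corner, so \<open>r\<close> is approached along the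
    diagonal points \<open>(x, x)\<close> with \<open>x < r\<close>.\<close>
  have "r \<le> c / (a + b)"
  proof (rule dense_le)
    fix x assume "x < r"
    then have "(a + b) * x \<le> c"
      using le[of x x] by (simp add: algebra_simps)
    then show "x \<le> c / (a + b)"
      using ab_pos by (simp add: field_simps)
  qed
  show thesis
  proof
    show "0 \<le> a / (a + b)" "a / (a + b) \<le> 1"
      using a b ab_pos by auto
    fix v assume "v \<in> K"
    have "r \<le> (a * f v + b * g v) / (a + b)"
      using \<open>r \<le> c / (a + b)\<close> ge'[OF \<open>v \<in> K\<close>] ab_pos divide_right_mono[of c _ "a + b"] by fastforce
    also have "\<dots> = a / (a + b) * f v + (1 - a / (a + b)) * g v"
    proof -
      have "1 - a / (a + b) = b / (a + b)"
        using ab_pos by (simp add: field_simps)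
      then show ?thesis
        by (simp add: add_divide_distrib)
    qed
    finally show "r \<le> a / (a + b) * f v + (1 - a / (a + b)) * g v" .
  qed
qed

lemma convex_on_weighted_sum:
  fixes f :: "'i \<Rightarrow> 'v::real_vector \<Rightarrow> real"
  assumes "finite I" "convex K" "\<And>i. i \<in> I \<Longrightarrow> convex_on K (f i)" "\<And>i. i \<in> I \<Longrightarrow> 0 \<le> w i"
  shows "convex_on K (\<lambda>v. \<Sum>i\<in>I. w i * f i v)"
  using assms
proof (induction I rule: finite_induct)
  case empty
  then show ?case
    by (simp add: convex_on_def)
next
  case (insert i I)
  then show ?case
    by (simp add: convex_on_add convex_on_cmul)
qed

text \<open>The induction leaves \<open>K\<close> free: where \<open>f j\<close> is below
  \<open>r\<close>, the other functions must do the work, so the induction hypothesis on that convex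
  subset yields one average \<open>g\<close>. On all of \<open>K\<close> then \<open>f j\<close> or
  \<open>g\<close> reaches \<open>r\<close>, and two functions can be combined.\<close>

lemma finite_minimax:
  fixes f :: "'i \<Rightarrow> 'v::real_vector \<Rightarrow> real"
  assumes "finite I" "I \<noteq> {}" "\<And>i. i \<in> I \<Longrightarrow> convex_on K (f i)"
    and "\<And>v. v \<in> K \<Longrightarrow> \<exists>i\<in>I. r \<le> f i v"
  shows "\<exists>w. (\<forall>i\<in>I. 0 \<le> w i) \<and> sum w I = 1 \<and> (\<forall>v\<in>K. r \<le> (\<Sum>i\<in>I. w i * f i v))"
  using assms
proof (induction I arbitrary: K rule: finite_ne_induct)
  case (singleton i)
  then show ?case
    by (intro exI[of _ "\<lambda>_. 1"]) auto
next
  case (insert j J)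
  define K' where "K' = {v \<in> K. f j v < r}"
  have j: "convex_on K (f j)"
    using insert.prems by simp
  have "convex K'"
    unfolding K'_def unfolding convex_alt
  proof (intro ballI allI impI)
    fix x y t assume xy: "x \<in> {v \<in> K. f j v < r}" "y \<in> {v \<in> K. f j v < r}"
      and t: "0 \<le> t \<and> t \<le> (1::real)"
    have "f j ((1 - t) *\<^sub>R x + t *\<^sub>R y) \<le> (1 - t) * f j x + t * f j y"
      using convex_onD[OF j, of t x y] xy t by auto
    also have "\<dots> < r"
      using xy t by (intro convex_bound_lt) auto
    finally show "(1 - t) *\<^sub>R x + t *\<^sub>R y \<in> {v \<in> K. f j v < r}"
      using convex_on_imp_convex[OF j] xy t by (auto simp: convex_alt)
  qed
  then have "\<And>i. i \<in> J \<Longrightarrow> convex_on K' (f i)"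
    using insert.prems(1) by (auto intro: convex_on_subset simp: K'_def)
  moreover have "\<exists>i\<in>J. r \<le> f i v" if "v \<in> K'" for v
    using insert.prems(2)[of v] that by (auto simp: K'_def)
  ultimately obtain w where w: "\<forall>i\<in>J. 0 \<le> w i" "sum w J = 1"
    and w_ge: "\<forall>v\<in>K'. r \<le> (\<Sum>i\<in>J. w i * f i v)"
    using insert.IH[of K'] by auto
  have "convex_on K (\<lambda>v. \<Sum>i\<in>J. w i * f i v)"
    using insert.hyps insert.prems w convex_on_imp_convex[OF j]
    by (intro convex_on_weighted_sum) auto
  moreover have "r \<le> f j v \<or> r \<le> (\<Sum>i\<in>J. w i * f i v)" if "v \<in> K" for v
    using w_ge that by (cases "f j v < r") (auto simp: K'_def)
  ultimately obtain c where c: "0 \<le> c" "c \<le> 1"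
    and c_ge: "\<And>v. v \<in> K \<Longrightarrow> r \<le> c * f j v + (1 - c) * (\<Sum>i\<in>J. w i * f i v)"
    using two_function_minimax[OF j, of "\<lambda>v. \<Sum>i\<in>J. w i * f i v" r] by blast
  define w' where "w' i = (if i = j then c else (1 - c) * w i)" for i
  have w': "w' j = c" "\<And>i. i \<in> J \<Longrightarrow> w' i = (1 - c) * w i"
    using insert.hyps by (auto simp: w'_def)
  show ?case
  proof (intro exI[of _ w'] conjI ballI)
    show "0 \<le> w' i" if "i \<in> insert j J" for i
      using that c w w' by auto
    show "sum w' (insert j J) = 1"
      using insert.hyps w w' by (simp add: sum_distrib_left[symmetric])
    show "r \<le> (\<Sum>i\<in>insert j J. w' i * f i v)" if "v \<in> K" for v
      using insert.hyps w' c_ge[OF that] by (simp add: sum_distrib_left mult.assoc)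
  qed
qed

text \<open>The real-valued result applies on the convex set where all \<open>f i\<close> are
  finite. At every other point some \<open>f i\<close> is infinite, and a positive weight on each
  index makes the weighted sum infinite too.\<close>

lemma finite_minimax_ennreal:
  fixes f :: "'i \<Rightarrow> 'v::real_vector \<Rightarrow> ennreal"
  assumes I: "finite I" "I \<noteq> {}" and "convex K"
    and conv: "\<And>i x y u v. \<lbrakk>i \<in> I; x \<in> K; y \<in> K; 0 < u; 0 < v; u + v = 1\<rbrakk> \<Longrightarrow>
      f i (u *\<^sub>R x + v *\<^sub>R y) \<le> ennreal u * f i x + ennreal v * f i y"
    and ge: "\<And>v. v \<in> K \<Longrightarrow> \<exists>i\<in>I. ennreal r \<le> f i v"
    and s: "0 \<le> s" "s < r"
  shows "\<exists>w. (\<forall>i\<in>I. 0 \<le> w i) \<and> sum w I = 1 \<and> (\<forall>v\<in>K. ennreal s \<le> (\<Sum>i\<in>I. ennreal (w i) * f i v))"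
proof -
  define K' where "K' = {v \<in> K. \<forall>i\<in>I. f i v < \<top>}"
  have fin: "ennreal u * f i x + ennreal v * f i y < \<top>"
    if "x \<in> K'" "y \<in> K'" "i \<in> I" for i x y u v
    using that by (auto simp: K'_def ennreal_mult_less_top)
  have "convex K'"
    unfolding convex_alt
  proof (intro ballI allI impI)
    fix x y t assume xy: "x \<in> K'" "y \<in> K'" and t: "0 \<le> t \<and> t \<le> (1::real)"
    show "(1 - t) *\<^sub>R x + t *\<^sub>R y \<in> K'"
    proof (cases "t = 0 \<or> t = 1")
      case False
      then have "f i ((1 - t) *\<^sub>R x + t *\<^sub>R y) < \<top>" if "i \<in> I" for i
        using conv[of i x y "1 - t" t] fin[OF xy that, of "1 - t" t] xy t that
        by (auto simp: K'_def intro: le_less_trans)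
      then show ?thesis
        using \<open>convex K\<close> xy t by (auto simp: K'_def convex_alt)
    qed (use xy in auto)
  qed
  have conv': "convex_on K' (\<lambda>v. enn2real (f i v))" if "i \<in> I" for i
  proof (rule convex_onI)
    fix t x y assume t: "0 < t" "t < (1::real)" and xy: "x \<in> K'" "y \<in> K'"
    have "enn2real (f i ((1 - t) *\<^sub>R x + t *\<^sub>R y)) \<le> enn2real (ennreal (1 - t) * f i x + ennreal t * f i y)"
      using conv[of i x y "1 - t" t] fin[OF xy that] xy t that
      by (intro enn2real_mono) (auto simp: K'_def)
    also have "\<dots> = (1 - t) * enn2real (f i x) + t * enn2real (f i y)"
      using t xy that by (subst enn2real_plus) (auto simp: K'_def enn2real_mult ennreal_mult_less_top)
    finally show "enn2real (f i ((1 - t) *\<^sub>R x + t *\<^sub>R y)) \<le> \<dots>" .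
  qed fact
  have ge': "\<exists>i\<in>I. r \<le> enn2real (f i v)" if v: "v \<in> K'" for v
  proof -
    obtain i where "i \<in> I" "ennreal r \<le> f i v"
      using v ge by (auto simp: K'_def)
    then have "r \<le> enn2real (f i v)"
      using v s enn2real_mono[of "ennreal r" "f i v"] by (auto simp: K'_def)
    then show ?thesis
      using \<open>i \<in> I\<close> by auto
  qed
  obtain w where w: "\<forall>i\<in>I. 0 \<le> w i" "sum w I = 1"
    and w_ge: "\<forall>v\<in>K'. r \<le> (\<Sum>i\<in>I. w i * enn2real (f i v))"
    using finite_minimax[OF I conv' ge'] by auto
  \<comment> \<open>Chosen so that scaling the old weights by \<open>1 - e\<close> lowers the bound
    from \<open>r\<close> to exactly \<open>s\<close>; the strict gap gives
    \<open>0 < e\<close>.\<close>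
  define e where "e = 1 - s / r"
  have e: "0 < e" "e \<le> 1" "(1 - e) * r = s"
    using s by (auto simp: e_def field_simps)
  define w' where "w' i = (1 - e) * w i + e / card I" for i
  have card: "0 < card I"
    using I by (simp add: card_gt_0_iff)
  have w'_ge: "(1 - e) * w i \<le> w' i" for i
    using e by (simp add: w'_def)
  have w'_pos: "0 < w' i" if "i \<in> I" for i
    using e w that card by (auto simp: w'_def intro!: add_nonneg_pos)
  show ?thesis
  proof (intro exI[of _ w'] conjI ballI)
    show "0 \<le> w' i" if "i \<in> I" for i
      using w'_pos[OF that] by simp
    show "sum w' I = 1"
      using w card by (simp add: w'_def sum.distrib sum_distrib_left[symmetric])
    show "ennreal s \<le> (\<Sum>i\<in>I. ennreal (w' i) * f i v)" if v: "v \<in> K" for v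
    proof (cases "v \<in> K'")
      case True
      have "s \<le> (1 - e) * (\<Sum>i\<in>I. w i * enn2real (f i v))"
        using w_ge True e mult_left_mono[of r _ "1 - e"] by fastforce
      also have "\<dots> \<le> (\<Sum>i\<in>I. w' i * enn2real (f i v))"
        unfolding sum_distrib_left mult.assoc[symmetric]
        by (intro sum_mono mult_right_mono w'_ge) auto
      finally have "ennreal s \<le> (\<Sum>i\<in>I. ennreal (w' i * enn2real (f i v)))"
        using w'_pos by (subst sum_ennreal) (auto intro!: mult_nonneg_nonneg simp: ennreal_leI less_imp_le)
      also have "\<dots> = (\<Sum>i\<in>I. ennreal (w' i) * f i v)"
        using w'_pos True by (intro sum.cong) (auto simp: ennreal_mult' K'_def less_imp_le)
      finally show ?thesis .
    next
      case False
      then obtain i where i: "i \<in> I" "f i v = \<top>"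
        using v unfolding K'_def less_top[symmetric] by blast
      then have "ennreal (w' i) * f i v = \<top>"
        using w'_pos[of i] by (simp add: ennreal_mult_top)
      then have "(\<Sum>i\<in>I. ennreal (w' i) * f i v) = \<top>"
        using I(1) i(1) by (auto simp: ennreal_sum_eq_top intro!: bexI[of _ i])
      then show ?thesis
        by simp
    qed
  qed
qed

text \<open>The sublevel sets at a level below the minimax value have no common point, so by
  compactness finitely many of them already have none; their indices form \<open>I\<close>.\<close>

lemma compact_minimax_ennreal:
  fixes f :: "'i \<Rightarrow> 'v::{real_vector, t2_space} \<Rightarrow> ennreal"
  assumes K: "compact K" "convex K" "K \<noteq> {}"
    and conv: "\<And>i x y u v. \<lbrakk>x \<in> K; y \<in> K; 0 < u; 0 < v; u + v = 1\<rbrakk> \<Longrightarrow>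
      f i (u *\<^sub>R x + v *\<^sub>R y) \<le> ennreal u * f i x + ennreal v * f i y"
    and closed: "\<And>i r. 0 \<le> r \<Longrightarrow> closed {v\<in>K. f i v \<le> ennreal r}"
    and s: "0 \<le> s" "ennreal s < (INF v\<in>K. SUP i. f i v)"
  shows "\<exists>I w. finite I \<and> (\<forall>i\<in>I. 0 \<le> w i) \<and> sum w I = 1 \<and>
    (\<forall>v\<in>K. ennreal s \<le> (\<Sum>i\<in>I. ennreal (w i) * f i v))"
proof -
  \<comment> \<open>An intermediate level serves twice: below the minimax value it empties the
    intersection of sublevel sets, and above \<open>s\<close> it leaves the gap consumed by the
    uniform share.\<close>
  obtain r' where r': "ennreal s < r'" "r' < (INF v\<in>K. SUP i. f i v)"
    using dense[OF s(2)] by auto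
  define r where "r = enn2real r'"
  have r_eq: "r' = ennreal r" and "0 \<le> r"
    using r'(2) using less_le_trans[OF r'(2) top_greatest] by (auto simp: r_def)
  then have "s < r"
    using r'(1) s by (simp add: ennreal_less_iff)
  have "K \<inter> (\<Inter>i. {v\<in>K. f i v \<le> ennreal r}) = {}"
  proof -
    have "False" if "v \<in> K" "\<And>i. f i v \<le> ennreal r" for v
    proof -
      have "(INF v\<in>K. SUP i. f i v) \<le> (SUP i. f i v)"
        using that by (intro INF_lower)
      also have "\<dots> \<le> ennreal r"
        using that by (intro SUP_least)
      finally show False
        using r'(2) r_eq by simp
    qed
    then show ?thesis by auto
  qed
  then obtain I where I: "finite I" "K \<inter> (\<Inter>i\<in>I. {v\<in>K. f i v \<le> ennreal r}) = {}"
    using compact_imp_fip_image[of K UNIV "\<lambda>i. {v\<in>K. f i v \<le> ennreal r}"] K(1) closed[OF \<open>0 \<le> r\<close>]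
    by auto
  then have "I \<noteq> {}"
    using K by auto
  have "\<exists>i\<in>I. ennreal r \<le> f i v" if "v \<in> K" for v
  proof -
    have "\<exists>i\<in>I. \<not> f i v \<le> ennreal r"
      using I(2) that by blast
    then show ?thesis
      by (meson linear)
  qed
  from finite_minimax_ennreal[OF I(1) \<open>I \<noteq> {}\<close> K(2) conv this s(1) \<open>s < r\<close>]
  show ?thesis
    using I(1) by blast
qed

section \<open>Renyi divergence\<close>

text \<open>A real-valued stand-in for \<open>renyi_sum\<close>. For \<open>a > 1\<close> it differs
  where \<open>pmf Q x = 0 < pmf P x\<close>: there \<open>0 powr (1 - a) = 0\<close> drops a term
  that should be infinite, so the two are identified only under absolute continuity.\<close>

definition hellinger_sum :: "real \<Rightarrow> 'x::finite pmf \<Rightarrow> 'x pmf \<Rightarrow> real" where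
  "hellinger_sum a P Q = (\<Sum>x\<in>UNIV. pmf P x powr a * pmf Q x powr (1 - a))"

lemma hellinger_sum_nonneg: "0 \<le> hellinger_sum a P Q"
  by (simp add: hellinger_sum_def sum_nonneg)

text \<open>The criterion does not mention \<open>a\<close>, so positivity can be carried from one
  order to another.\<close>

lemma hellinger_sum_eq_0_iff: "hellinger_sum a P Q = 0 \<longleftrightarrow> (\<forall>x. pmf P x = 0 \<or> pmf Q x = 0)"
  by (simp add: hellinger_sum_def sum_nonneg_eq_0_iff)

lemma hellinger_sum_le_1:
  assumes "0 \<le> a" "a < 1"
  shows "hellinger_sum a P Q \<le> 1"
proof (cases "a = 0")
  case True
  have "hellinger_sum a P Q \<le> (\<Sum>x\<in>UNIV. pmf Q x)"
    unfolding hellinger_sum_def True by (intro sum_mono) auto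
  then show ?thesis
    by (simp add: sum_pmf_UNIV)
next
  case False
  then have "ennreal (hellinger_sum a P Q) \<le> 1"
    using assms renyi_sum_le_1[of a P Q] by (simp add: renyi_sum_def hellinger_sum_def)
  then show ?thesis
    by simp
qed

lemma renyi_sum_less_1: "a < 1 \<Longrightarrow> renyi_sum a P Q = ennreal (hellinger_sum a P Q)"
  by (simp add: renyi_sum_def hellinger_sum_def)

lemma renyi_sum_top:
  assumes "1 < a" "pmf P x \<noteq> 0" "pmf Q x = 0"
  shows "renyi_sum a P Q = \<top>"
proof -
  have "ennreal (pmf P x powr a) / ennreal (pmf Q x powr (a - 1)) = \<top>"
    using assms by (simp add: ennreal_divide_eq_top_iff)
  then show ?thesis
    using assms by (auto simp: renyi_sum_def ennreal_sum_eq_top intro!: exI[of _ x])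
qed

lemma renyi_sum_abs_cont:
  assumes "1 < a" "\<And>x. pmf Q x = 0 \<Longrightarrow> pmf P x = 0"
  shows "renyi_sum a P Q = ennreal (hellinger_sum a P Q)"
proof -
  have "ennreal (pmf P x powr a) / ennreal (pmf Q x powr (a - 1)) = ennreal (pmf P x powr a * pmf Q x powr (1 - a))"
    for x
  proof (cases "pmf Q x = 0")
    case True
    then show ?thesis
      using assms(2)[of x] by simp
  next
    case False
    then have "0 < pmf Q x powr (a - 1)"
      by simp
    moreover have "pmf Q x powr (1 - a) = 1 / pmf Q x powr (a - 1)"
      by (metis minus_diff_eq powr_minus_divide)
    ultimately show ?thesis
      by (simp add: divide_ennreal)
  qed
  then show ?thesis
    using assms(1) by (simp add: renyi_sum_def hellinger_sum_def)
qed

text \<open>The order 0 is included: since \<open>0 powr 0 = 0\<close>, the sum is then the \<open>Q\<close>-mass of the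
  support of \<open>P\<close>, which is the limit for \<open>a \<down> 0\<close>.\<close>

lemma renyi_div_simple_eq:
  assumes "a \<noteq> 1"
  shows "renyi_div_simple a P Q =
    (if a < 1 \<and> hellinger_sum a P Q = 0 \<or> 1 < a \<and> (\<exists>x. pmf P x \<noteq> 0 \<and> pmf Q x = 0) then \<top>
     else ennreal (ln (hellinger_sum a P Q) / (a - 1)))"
proof (cases "a < 1")
  case True
  show ?thesis
  proof (cases "hellinger_sum a P Q = 0")
    case True
    then show ?thesis
      using \<open>a < 1\<close> by (simp add: renyi_div_simple_def renyi_sum_less_1 ln_ennreal_def e2ennreal_infty
          ereal_mult_infty)
  next
    case False
    then show ?thesis
      using \<open>a < 1\<close> hellinger_sum_nonneg[of a P Q]
      by (simp add: renyi_div_simple_def renyi_sum_less_1 ln_ennreal_def)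
  qed
next
  case False
  then have "1 < a"
    using assms by simp
  show ?thesis
  proof (cases "\<exists>x. pmf P x \<noteq> 0 \<and> pmf Q x = 0")
    case True
    then have "renyi_sum a P Q = \<top>"
      using renyi_sum_top \<open>1 < a\<close> by blast
    then show ?thesis
      using \<open>1 < a\<close> True by (simp add: renyi_div_simple_def ln_ennreal_def)
  next
    case False
    then have eq: "renyi_sum a P Q = ennreal (hellinger_sum a P Q)"
      using renyi_sum_abs_cont \<open>1 < a\<close> by blast
    then have "0 < hellinger_sum a P Q"
      using renyi_sum_ge_1[OF \<open>1 < a\<close>, of P Q] by (simp add: ennreal_ge_1)
    then show ?thesis
      using \<open>1 < a\<close> False eq by (simp add: renyi_div_simple_def ln_ennreal_def)
  qed
qed

text \<open>Removes the logarithm, to prepare closedness of sublevel sets. Below 1 the positive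
  bound \<open>exp ((a - 1) * r)\<close> excludes a vanishing sum; above 1 the extended sum
  \<open>renyi_sum\<close> is kept, because it records infinite divergence correctly.\<close>

lemma renyi_div_simple_le_iff:
  assumes "0 \<le> r" "a \<noteq> 1"
  shows "renyi_div_simple a P Q \<le> ennreal r \<longleftrightarrow>
    (if a < 1 then exp ((a - 1) * r) \<le> hellinger_sum a P Q
     else renyi_sum a P Q \<le> ennreal (exp ((a - 1) * r)))"
proof (cases "a < 1")
  case True
  have "0 < exp ((a - 1) * r)"
    by simp
  moreover have "ln h / (a - 1) \<le> r \<longleftrightarrow> exp ((a - 1) * r) \<le> h" if "0 < h" for h
    using True that by (subst ln_ge_iff[symmetric]) (auto simp: field_simps)
  ultimately show ?thesis
    using True assms hellinger_sum_nonneg[of a P Q]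
    by (auto simp: renyi_div_simple_eq top_unique order_less_le)
next
  case False
  then have "1 < a"
    using assms by simp
  show ?thesis
  proof (cases "\<exists>x. pmf P x \<noteq> 0 \<and> pmf Q x = 0")
    case True
    then show ?thesis
      using \<open>1 < a\<close> renyi_sum_top[of a P _ Q] by (auto simp: renyi_div_simple_eq top_unique)
  next
    case False
    then have eq: "renyi_sum a P Q = ennreal (hellinger_sum a P Q)"
      using renyi_sum_abs_cont \<open>1 < a\<close> by blast
    then have pos: "0 < hellinger_sum a P Q"
      using renyi_sum_ge_1[OF \<open>1 < a\<close>, of P Q] by (simp add: ennreal_ge_1)
    then have "ln (hellinger_sum a P Q) / (a - 1) \<le> r \<longleftrightarrow> hellinger_sum a P Q \<le> exp ((a - 1) * r)"
      using \<open>1 < a\<close> by (subst ln_le_cancel_iff[symmetric]) (auto simp: field_simps)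
    then show ?thesis
      using \<open>1 < a\<close> False eq assms pos by (auto simp: renyi_div_simple_eq)
  qed
qed

section \<open>Monotonicity in the order\<close>

text \<open>Since \<open>a = c * b + (1 - c) * 1\<close>, this is log-convexity in the order between
  \<open>b\<close> and 1, where the comparison sum is that of \<open>P\<close> itself. It is
  Hoelder's inequality for \<open>A\<close> and \<open>pmf P\<close>, proved by
  \<open>young_powr\<close> on \<open>A x / H\<close> and \<open>pmf P x\<close>, both of total mass
  1.\<close>

lemma hellinger_sum_le_powr:
  assumes c: "0 < c" "c < 1" "1 - a = c * (1 - b)" and pos: "0 < hellinger_sum b P Q"
  shows "hellinger_sum a P Q \<le> hellinger_sum b P Q powr c"
proof -
  define H where "H = hellinger_sum b P Q"
  have H: "0 < H"
    using pos by (simp add: H_def)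
  define A where "A x = pmf P x powr b * pmf Q x powr (1 - b)" for x
  have H_sum: "(\<Sum>x\<in>UNIV. A x) = H"
    by (simp add: H_def hellinger_sum_def A_def)
  have "pmf P x powr a * pmf Q x powr (1 - a) \<le> H powr c * (c * (A x / H) + (1 - c) * pmf P x)" for x
  proof -
    have "pmf P x powr a * pmf Q x powr (1 - a) = A x powr c * pmf P x powr (1 - c)"
    proof (cases "pmf P x = 0")
      case False
      have "a = b * c + (1 - c)"
        using c by (simp add: algebra_simps)
      then have "pmf P x powr a = pmf P x powr (b * c) * pmf P x powr (1 - c)"
        by (metis powr_add)
      then show ?thesis
        using c by (simp add: A_def powr_mult powr_powr mult.commute)
    qed (use c in \<open>simp add: A_def\<close>)
    also have "\<dots> = H powr c * ((A x / H) powr c * pmf P x powr (1 - c))"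
      using H by (simp add: powr_divide A_def)
    also have "\<dots> \<le> H powr c * (c * (A x / H) + (1 - c) * pmf P x)"
      using H c by (intro mult_left_mono young_powr) (auto simp: A_def)
    finally show ?thesis .
  qed
  then have "hellinger_sum a P Q \<le> (\<Sum>x\<in>UNIV. H powr c * (c * (A x / H) + (1 - c) * pmf P x))"
    unfolding hellinger_sum_def by (intro sum_mono) auto
  also have "\<dots> = H powr c * (c * ((\<Sum>x\<in>UNIV. A x) / H) + (1 - c))"
    by (simp add: sum_distrib_left[symmetric] sum.distrib sum_divide_distrib[symmetric] sum_pmf_UNIV)
  also have "\<dots> = H powr c"
    using H H_sum by simp
  finally show ?thesis
    by (simp add: H_def)
qed

text \<open>On either side of 1, the sum of the order nearer to 1 is bounded by a power of the other
  sum. The nearer order is \<open>b\<close> below 1 and \<open>a\<close> above 1, and the sign of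
  the divisor changes accordingly, so both cases give the same direction.\<close>

lemma renyi_div_simple_mono:
  assumes "a \<le> b" "b < 1 \<or> 1 < a"
  shows "renyi_div_simple a P Q \<le> renyi_div_simple b P Q"
proof (cases "a = b")
  case False
  then have "a < b"
    using assms by simp
  have pos_iff: "0 < hellinger_sum a P Q \<longleftrightarrow> 0 < hellinger_sum b P Q"
    using hellinger_sum_eq_0_iff[of a P Q] hellinger_sum_eq_0_iff[of b P Q]
      hellinger_sum_nonneg[of a P Q] hellinger_sum_nonneg[of b P Q]
    by (metis order_less_le)
  show ?thesis
  proof (cases "renyi_div_simple b P Q = \<top>")
    case False
    have pos: "0 < hellinger_sum b P Q"
    proof (cases "b < 1")
      case True
      then show ?thesis
        using False hellinger_sum_nonneg[of b P Q] by (auto simp: renyi_div_simple_eq order_less_le)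
    next
      case b: False
      then have "1 < b"
        using assms \<open>a < b\<close> by simp
      then have "\<And>x. pmf Q x = 0 \<Longrightarrow> pmf P x = 0"
        using False by (auto simp: renyi_div_simple_eq split: if_splits)
      then have "renyi_sum b P Q = ennreal (hellinger_sum b P Q)"
        using \<open>1 < b\<close> by (intro renyi_sum_abs_cont) auto
      then show ?thesis
        using renyi_sum_ge_1[OF \<open>1 < b\<close>, of P Q] by (simp add: ennreal_ge_1)
    qed
    have "ln (hellinger_sum a P Q) / (a - 1) \<le> ln (hellinger_sum b P Q) / (b - 1)"
    proof (cases "b < 1")
      case True
      define c where "c = (1 - b) / (1 - a)"
      have c: "0 < c" "c < 1" "1 - b = c * (1 - a)"
        using True \<open>a < b\<close> by (auto simp: c_def)
      have "hellinger_sum b P Q \<le> hellinger_sum a P Q powr c"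
        using pos pos_iff by (intro hellinger_sum_le_powr c) auto
      then have "ln (hellinger_sum b P Q) \<le> ln (hellinger_sum a P Q powr c)"
        using pos pos_iff by (intro ln_mono) auto
      then have "ln (hellinger_sum b P Q) \<le> c * ln (hellinger_sum a P Q)"
        using pos pos_iff by (simp only: ln_powr)
      moreover have "b - 1 = c * (a - 1)"
        using c by (simp add: algebra_simps)
      ultimately show ?thesis
        using c True divide_right_mono_neg[of "ln (hellinger_sum b P Q)" "c * ln (hellinger_sum a P Q)" "b - 1"]
        by simp
    next
      case b: False
      then have "1 < a"
        using assms by simp
      define c where "c = (a - 1) / (b - 1)"
      have c: "0 < c" "c < 1" "1 - a = c * (1 - b)" 
        using \<open>1 < a\<close> \<open>a < b\<close> by (auto simp: c_def field_simps)
      have "hellinger_sum a P Q \<le> hellinger_sum b P Q powr c"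
        using pos by (intro hellinger_sum_le_powr c)
      then have "ln (hellinger_sum a P Q) \<le> ln (hellinger_sum b P Q powr c)"
        using pos pos_iff by (intro ln_mono) auto
      then have "ln (hellinger_sum a P Q) \<le> c * ln (hellinger_sum b P Q)"
        by (simp only: ln_powr)
      moreover have "a - 1 = c * (b - 1)"
        using c by (simp add: algebra_simps)
      ultimately have "ln (hellinger_sum a P Q) / (a - 1) \<le> c * ln (hellinger_sum b P Q) / (c * (b - 1))"
        using \<open>1 < a\<close> divide_right_mono[of "ln (hellinger_sum a P Q)" "c * ln (hellinger_sum b P Q)" "a - 1"]
        by auto
      then show ?thesis
        using c by simp
    qed
    then show ?thesis
      using False assms pos pos_iff \<open>a < b\<close>
      by (auto simp: renyi_div_simple_eq intro: ennreal_leI split: if_splits)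
  qed simp
qed simp

section \<open>Convexity in the second distribution\<close>

text \<open>The map \<open>q powr (1 - a)\<close> is concave, hence so is the sum, and the logarithm
  is increasing and concave.\<close>

lemma hellinger_sum_mixture_ge:
  assumes a: "0 \<le> a" "a < 1" and uv: "0 < u" "0 < v" "u + v = 1"
    and mix: "\<And>x. pmf Q x = u * pmf Q0 x + v * pmf Q1 x"
    and pos: "0 < hellinger_sum a P Q0" "0 < hellinger_sum a P Q1"
  shows "u * ln (hellinger_sum a P Q0) + v * ln (hellinger_sum a P Q1) \<le> ln (hellinger_sum a P Q)"
proof -
  have powr_ge: "u * pmf Q0 x powr (1 - a) + v * pmf Q1 x powr (1 - a) \<le> pmf Q x powr (1 - a)" for x
  proof (cases "a = 0 \<or> pmf Q x = 0")
    case True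
    then show ?thesis
      using mix[of x] uv by (auto simp: add_nonneg_eq_0_iff)
  next
    case False
    then have q: "0 < pmf Q x" "0 < a"
      using a by (auto simp: order_less_le)
    define c where "c = 1 - a"
    have "0 < c" "c < 1"
      using a q by (auto simp: c_def)
    note young = young_powr[OF pmf_nonneg pmf_nonneg this]
    \<comment> \<open>The factor \<open>pmf Q x powr (1 - c)\<close> lets \<open>young_powr\<close>
      compare \<open>Q0\<close> and \<open>Q1\<close> with the mixture; being positive, it is
      cancelled at the end.\<close>
    have "(u * pmf Q0 x powr c + v * pmf Q1 x powr c) * pmf Q x powr (1 - c) =
        u * (pmf Q0 x powr c * pmf Q x powr (1 - c)) + v * (pmf Q1 x powr c * pmf Q x powr (1 - c))"
      by (simp add: algebra_simps)
    also have "\<dots> \<le> u * (c * pmf Q0 x + (1 - c) * pmf Q x) + v * (c * pmf Q1 x + (1 - c) * pmf Q x)"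
      using uv by (intro add_mono mult_left_mono young) auto
    also have "\<dots> = c * (u * pmf Q0 x + v * pmf Q1 x) + (1 - c) * ((u + v) * pmf Q x)"
      by (simp add: algebra_simps)
    also have "\<dots> = pmf Q x powr c * pmf Q x powr (1 - c)"
      using uv q unfolding mix[symmetric] by (simp add: powr_add[symmetric] algebra_simps)
    finally show ?thesis
      using q by (simp add: c_def)
  qed
  have "u * hellinger_sum a P Q0 + v * hellinger_sum a P Q1 =
      (\<Sum>x\<in>UNIV. pmf P x powr a * (u * pmf Q0 x powr (1 - a) + v * pmf Q1 x powr (1 - a)))"
    by (simp add: hellinger_sum_def sum_distrib_left sum.distrib algebra_simps)
  also have "\<dots> \<le> hellinger_sum a P Q"
    unfolding hellinger_sum_def by (intro sum_mono mult_left_mono powr_ge) auto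
  finally have ge: "u * hellinger_sum a P Q0 + v * hellinger_sum a P Q1 \<le> hellinger_sum a P Q" .
  have "u * ln (hellinger_sum a P Q0) + v * ln (hellinger_sum a P Q1) =
      ln (hellinger_sum a P Q0 powr u * hellinger_sum a P Q1 powr v)"
    using pos by (simp add: ln_mult ln_powr)
  also have "hellinger_sum a P Q0 powr u * hellinger_sum a P Q1 powr (1 - u) \<le>
      u * hellinger_sum a P Q0 + (1 - u) * hellinger_sum a P Q1"
    using uv pos by (intro young_powr) auto
  then have "ln (hellinger_sum a P Q0 powr u * hellinger_sum a P Q1 powr v) \<le> ln (hellinger_sum a P Q)"
    using ge uv pos by (subst ln_le_cancel_iff) (auto simp: eq_diff_eq[symmetric] intro!: add_pos_pos less_le_trans[OF _ ge])
  finally show ?thesis .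
qed

text \<open>AM-GM bounds the mixture below by \<open>pmf Q0 x powr u * pmf Q1 x powr v\<close>, and
  the negative exponent \<open>1 - a\<close> reverses this. Each term is then at most a geometric
  mean of the terms for \<open>Q0\<close> and \<open>Q1\<close>, and Hoelder's inequality bounds the
  sum by \<open>H0 powr u * H1 powr v\<close>.\<close>

lemma hellinger_sum_mixture_le:
  assumes a: "1 < a" and uv: "0 < u" "0 < v" "u + v = 1"
    and mix: "\<And>x. pmf Q x = u * pmf Q0 x + v * pmf Q1 x"
    and pos: "0 < hellinger_sum a P Q0" "0 < hellinger_sum a P Q1"
    and ac: "\<And>x. pmf Q0 x = 0 \<Longrightarrow> pmf P x = 0" "\<And>x. pmf Q1 x = 0 \<Longrightarrow> pmf P x = 0"
  shows "ln (hellinger_sum a P Q) \<le> u * ln (hellinger_sum a P Q0) + v * ln (hellinger_sum a P Q1)"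
proof -
  define H0 H1 where "H0 = hellinger_sum a P Q0" "H1 = hellinger_sum a P Q1"
  have H: "0 < H0" "0 < H1"
    using pos by (auto simp: H0_H1_def)
  define A0 where "A0 x = pmf P x powr a * pmf Q0 x powr (1 - a)" for x
  define A1 where "A1 x = pmf P x powr a * pmf Q1 x powr (1 - a)" for x
  have v: "v = 1 - u"
    using uv by simp
  have "pmf P x powr a * pmf Q x powr (1 - a) \<le> H0 powr u * H1 powr v * (u * (A0 x / H0) + v * (A1 x / H1))" for x
  proof (cases "pmf P x = 0")
    case False
    then have q: "0 < pmf Q0 x" "0 < pmf Q1 x"
      using ac by (metis order_less_le pmf_nonneg)+
    have "pmf Q0 x powr u * pmf Q1 x powr v \<le> pmf Q x"
      unfolding mix v using uv by (intro young_powr) auto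
    then have "pmf Q x powr (1 - a) \<le> (pmf Q0 x powr u * pmf Q1 x powr v) powr (1 - a)"
      using a q by (intro powr_mono2') auto
    also have "\<dots> = (pmf Q0 x powr (1 - a)) powr u * (pmf Q1 x powr (1 - a)) powr v"
      by (simp add: powr_mult powr_powr mult.commute)
    \<comment> \<open>Writing the exponent 1 as \<open>u + v\<close> shares the factor of
      \<open>P\<close> between \<open>A0\<close> and \<open>A1\<close>.\<close>
    finally have "pmf P x powr a * pmf Q x powr (1 - a) \<le>
        (pmf P x powr a) powr (u + v) * ((pmf Q0 x powr (1 - a)) powr u * (pmf Q1 x powr (1 - a)) powr v)"
      using uv by (intro mult_mono) auto
    also have "\<dots> = A0 x powr u * A1 x powr v"
      unfolding powr_add A0_def A1_def by (simp add: powr_mult)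
    also have "\<dots> = H0 powr u * H1 powr v * ((A0 x / H0) powr u * (A1 x / H1) powr (1 - u))"
      using H unfolding v by (simp add: powr_divide A0_def A1_def)
    also have "\<dots> \<le> H0 powr u * H1 powr v * (u * (A0 x / H0) + (1 - u) * (A1 x / H1))"
      using H uv by (intro mult_left_mono young_powr) (auto simp: A0_def A1_def)
    finally show ?thesis
      by (simp add: v)
  qed (use H uv in \<open>simp add: A0_def A1_def\<close>)
  then have "hellinger_sum a P Q \<le> (\<Sum>x\<in>UNIV. H0 powr u * H1 powr v * (u * (A0 x / H0) + v * (A1 x / H1)))"
    unfolding hellinger_sum_def by (intro sum_mono) auto
  also have "\<dots> = H0 powr u * H1 powr v * (u * ((\<Sum>x\<in>UNIV. A0 x) / H0) + v * ((\<Sum>x\<in>UNIV. A1 x) / H1))"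
    by (simp add: sum_distrib_left[symmetric] sum.distrib sum_divide_distrib[symmetric])
  also have "\<dots> = H0 powr u * H1 powr v"
    using H uv by (simp add: A0_def A1_def H0_H1_def hellinger_sum_def)
  finally have le: "hellinger_sum a P Q \<le> H0 powr u * H1 powr v" .
  have "hellinger_sum a P Q \<noteq> 0"
  proof -
    obtain x where "pmf P x \<noteq> 0" "pmf Q0 x \<noteq> 0"
      using pos(1) hellinger_sum_eq_0_iff[of a P Q0] by auto
    then have "pmf Q x \<noteq> 0"
      using mix[of x] uv by (auto simp: add_nonneg_eq_0_iff)
    then show ?thesis
      using \<open>pmf P x \<noteq> 0\<close> hellinger_sum_eq_0_iff by blast
  qed
  then have "ln (hellinger_sum a P Q) \<le> ln (H0 powr u * H1 powr v)"
    using le H hellinger_sum_nonneg[of a P Q] by (subst ln_le_cancel_iff) auto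
  also have "\<dots> = u * ln H0 + v * ln H1"
    using H by (simp add: ln_mult ln_powr)
  finally show ?thesis
    by (simp add: H0_H1_def)
qed


lemma renyi_div_simple_convex:
  assumes a: "0 \<le> a" "a \<noteq> 1" and uv: "0 < u" "0 < v" "u + v = 1"
    and mix: "\<And>x. pmf Q x = u * pmf Q0 x + v * pmf Q1 x"
  shows "renyi_div_simple a P Q \<le> ennreal u * renyi_div_simple a P Q0 + ennreal v * renyi_div_simple a P Q1"
proof (cases "renyi_div_simple a P Q0 = \<top> \<or> renyi_div_simple a P Q1 = \<top>")
  case True
  then show ?thesis
    using uv by (auto simp: ennreal_mult_top)
next
  case fin: False
  define L where "L R = ln (hellinger_sum a P R) / (a - 1)" for R
  \<comment> \<open>The sign of \<open>L R\<close> matters: it lets \<open>ennreal\<close>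
    distribute over the mixture of the two values without truncation.\<close>
  have L: "renyi_div_simple a P R = ennreal (L R) \<and> 0 < hellinger_sum a P R \<and> 0 \<le> L R"
    if "renyi_div_simple a P R \<noteq> \<top>" for R
  proof (cases "a < 1")
    case True
    have "hellinger_sum a P R \<le> 1"
      using a True by (intro hellinger_sum_le_1)
    then show ?thesis
      using True that hellinger_sum_nonneg[of a P R]
      by (auto simp: renyi_div_simple_eq L_def order_less_le divide_nonpos_neg split: if_splits)
  next
    case False
    then have "1 < a"
      using a by simp
    have "\<And>x. pmf R x = 0 \<Longrightarrow> pmf P x = 0"
      using that \<open>1 < a\<close> by (auto simp: renyi_div_simple_eq split: if_splits)
    then have "renyi_sum a P R = ennreal (hellinger_sum a P R)"
      using \<open>1 < a\<close> by (intro renyi_sum_abs_cont) auto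
    then have "1 \<le> hellinger_sum a P R"
      using renyi_sum_ge_1[OF \<open>1 < a\<close>, of P R] by (simp add: ennreal_ge_1)
    then show ?thesis
      using \<open>1 < a\<close> that by (auto simp: renyi_div_simple_eq L_def split: if_splits)
  qed
  have L0: "renyi_div_simple a P Q0 = ennreal (L Q0)" "0 < hellinger_sum a P Q0" "0 \<le> L Q0"
    and L1: "renyi_div_simple a P Q1 = ennreal (L Q1)" "0 < hellinger_sum a P Q1" "0 \<le> L Q1"
    using L[of Q0] L[of Q1] fin by auto
  have zero: "pmf Q0 x = 0 \<and> pmf Q1 x = 0" if "pmf Q x = 0" for x
    using that mix[of x] uv by (auto simp: add_nonneg_eq_0_iff)
  have "L Q \<le> u * L Q0 + v * L Q1" "renyi_div_simple a P Q = ennreal (L Q)"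
  proof -
    have "L Q \<le> (u * ln (hellinger_sum a P Q0) + v * ln (hellinger_sum a P Q1)) / (a - 1) \<and>
      renyi_div_simple a P Q = ennreal (L Q)"
    proof (cases "a < 1")
      case True
      have "hellinger_sum a P Q \<noteq> 0"
        using L0(2) zero hellinger_sum_eq_0_iff[of a P Q] hellinger_sum_eq_0_iff[of a P Q0]
        by (metis less_irrefl)
      then show ?thesis
        using True a hellinger_sum_mixture_ge[OF a(1) True uv mix L0(2) L1(2)]
        by (auto simp: L_def renyi_div_simple_eq divide_right_mono_neg)
    next
      case False
      then have "1 < a"
        using a by simp
      moreover have ac: "pmf Q0 x = 0 \<Longrightarrow> pmf P x = 0" "pmf Q1 x = 0 \<Longrightarrow> pmf P x = 0" for x
        using fin \<open>1 < a\<close> by (auto simp: renyi_div_simple_eq split: if_splits)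
      ultimately show ?thesis
        using hellinger_sum_mixture_le[OF \<open>1 < a\<close> uv mix L0(2) L1(2) ac] zero
        by (auto simp: L_def renyi_div_simple_eq divide_right_mono)
    qed
    then show "L Q \<le> u * L Q0 + v * L Q1" "renyi_div_simple a P Q = ennreal (L Q)"
      by (auto simp: L_def add_divide_distrib)
  qed
  then have "renyi_div_simple a P Q \<le> ennreal (u * L Q0 + v * L Q1)"
    by (simp add: ennreal_leI)
  also have "\<dots> = ennreal u * ennreal (L Q0) + ennreal v * ennreal (L Q1)"
    using uv L0 L1 by (simp add: ennreal_plus ennreal_mult)
  finally show ?thesis
    by (simp add: L0 L1)
qed

section \<open>Limiting orders as suprema\<close>

text \<open>Each term converges, those with \<open>pmf P x = 0\<close> being constantly 0. If the
  supports are disjoint, the divergence is constantly \<open>\<top>\<close> near 0 and at 0.\<close>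

lemma renyi_div_simple_tendsto_0:
  "((\<lambda>a. renyi_div_simple a P Q) \<longlongrightarrow> renyi_div_simple 0 P Q) (at_right 0)"
proof -
  have ev: "eventually (\<lambda>a. a \<in> {0<..<1::real}) (at_right 0)"
    by (rule eventually_at_right_real) simp
  show ?thesis
  proof (cases "hellinger_sum 0 P Q = 0")
    case True
    then have "hellinger_sum a P Q = 0" for a
      by (simp add: hellinger_sum_eq_0_iff)
    then have "eventually (\<lambda>a. renyi_div_simple a P Q = renyi_div_simple 0 P Q) (at_right 0)"
      using ev by (auto simp: renyi_div_simple_eq elim: eventually_mono)
    then show ?thesis
      by (rule tendsto_eventually)
  next
    case False
    then have pos: "hellinger_sum a P Q \<noteq> 0" for a
      by (simp add: hellinger_sum_eq_0_iff)
    have "((\<lambda>a. pmf P x powr a * pmf Q x powr (1 - a)) \<longlongrightarrow> pmf P x powr 0 * pmf Q x powr (1 - 0)) (at_right 0)" for x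
      by (cases "pmf P x = 0 \<or> pmf Q x = 0") (auto intro!: tendsto_eq_intros)
    then have "((\<lambda>a. hellinger_sum a P Q) \<longlongrightarrow> hellinger_sum 0 P Q) (at_right 0)"
      unfolding hellinger_sum_def by (intro tendsto_sum)
    then have "((\<lambda>a. ln (hellinger_sum a P Q) / (a - 1)) \<longlongrightarrow> ln (hellinger_sum 0 P Q) / (0 - 1)) (at_right 0)"
      using pos by (intro tendsto_intros) auto
    then have "((\<lambda>a. ennreal (ln (hellinger_sum a P Q) / (a - 1))) \<longlongrightarrow> renyi_div_simple 0 P Q) (at_right 0)"
      by (simp add: renyi_div_simple_eq pos tendsto_ennrealI)
    moreover have "eventually (\<lambda>a. ennreal (ln (hellinger_sum a P Q) / (a - 1)) = renyi_div_simple a P Q) (at_right 0)"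
      using ev by eventually_elim (auto simp: renyi_div_simple_eq pos)
    ultimately show ?thesis
      by (rule Lim_transform_eventually)
  qed
qed

lemma renyi_div_simple_tendsto_1:
  "((\<lambda>a. renyi_div_simple a P Q) \<longlongrightarrow> (SUP a\<in>{0<..<1}. renyi_div_simple a P Q)) (at_left 1)"
proof (rule increasing_tendsto)
  have "eventually (\<lambda>a. a \<in> {0<..<1::real}) (at_left 1)"
    by (rule eventually_at_left_real) simp
  then show "eventually (\<lambda>a. renyi_div_simple a P Q \<le> (SUP a\<in>{0<..<1}. renyi_div_simple a P Q)) (at_left 1)"
    by eventually_elim (rule SUP_upper)
next
  fix y assume "y < (SUP a\<in>{0<..<1}. renyi_div_simple a P Q)"
  then obtain b where b: "b \<in> {0<..<1}" "y < renyi_div_simple b P Q"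
    by (auto simp: less_SUP_iff)
  have "eventually (\<lambda>a. a \<in> {b<..<1}) (at_left 1)"
    using b by (intro eventually_at_left_real) simp
  then show "eventually (\<lambda>a. y < renyi_div_simple a P Q) (at_left 1)"
    by eventually_elim (rule less_le_trans[OF b(2) renyi_div_simple_mono], use b in auto)
qed

lemma renyi_div_simple_tendsto_top:
  "((\<lambda>a. renyi_div_simple a P Q) \<longlongrightarrow> (SUP a\<in>{1<..}. renyi_div_simple a P Q)) at_top"
proof (rule increasing_tendsto)
  show "eventually (\<lambda>a. renyi_div_simple a P Q \<le> (SUP a\<in>{1<..}. renyi_div_simple a P Q)) at_top"
    using eventually_gt_at_top[of 1] by eventually_elim (auto intro: SUP_upper)
next
  fix y assume "y < (SUP a\<in>{1<..}. renyi_div_simple a P Q)"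
  then obtain b where b: "1 < b" "y < renyi_div_simple b P Q"
    by (auto simp: less_SUP_iff)
  show "eventually (\<lambda>a. y < renyi_div_simple a P Q) at_top"
    using eventually_ge_at_top[of b]
    by eventually_elim (rule less_le_trans[OF b(2) renyi_div_simple_mono], use b in auto)
qed

text \<open>Monotonicity in the order turns the limits for the orders 1 and \<open>\<infinity>\<close> into suprema, which
  inherit convexity and lower semicontinuity from the simple orders.\<close>

definition simple_orders :: "ennreal \<Rightarrow> real set" where
  "simple_orders \<alpha> =
     (if \<alpha> = 1 then {0<..<1} else if \<alpha> = \<top> then {1<..} else {enn2real \<alpha>})"

lemma simple_orders_range:
  assumes "a \<in> simple_orders \<alpha>"
  shows "0 \<le> a" "a \<noteq> 1"
proof -
  have "enn2real \<alpha> \<noteq> 1" if "\<alpha> \<noteq> 1" "\<alpha> \<noteq> \<top>"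
    using that by (cases \<alpha>) auto
  then show "0 \<le> a" "a \<noteq> 1"
    using assms by (auto simp: simple_orders_def split: if_splits)
qed

text \<open>Treats all orders uniformly; apart from 1 and \<open>\<top>\<close> the index set is a
  singleton, and for \<open>\<alpha> = 0\<close> it is \<open>{0}\<close>, the limit being the
  closed form at 0.\<close>

lemma renyi_div_eq_SUP:
  "renyi_div \<alpha> P Q = (SUP a\<in>simple_orders \<alpha>. renyi_div_simple a P Q)"
proof -
  have "Lim (at_right 0) (\<lambda>a. renyi_div_simple a P Q) = renyi_div_simple 0 P Q"
    by (rule tendsto_Lim[OF _ renyi_div_simple_tendsto_0]) simp
  moreover have "Lim (at_left 1) (\<lambda>a. renyi_div_simple a P Q) = (SUP a\<in>{0<..<1}. renyi_div_simple a P Q)"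
    by (rule tendsto_Lim[OF _ renyi_div_simple_tendsto_1]) simp
  moreover have "Lim at_top (\<lambda>a. renyi_div_simple a P Q) = (SUP a\<in>{1<..}. renyi_div_simple a P Q)"
    by (rule tendsto_Lim[OF _ renyi_div_simple_tendsto_top]) simp
  ultimately show ?thesis
    by (simp add: renyi_div_def simple_orders_def)
qed

lemma renyi_div_convex:
  assumes uv: "0 < u" "0 < v" "u + v = 1"
    and mix: "\<And>x. pmf Q x = u * pmf Q0 x + v * pmf Q1 x"
  shows "renyi_div \<alpha> P Q \<le> ennreal u * renyi_div \<alpha> P Q0 + ennreal v * renyi_div \<alpha> P Q1"
  unfolding renyi_div_eq_SUP[of \<alpha> P Q]
proof (rule SUP_least)
  fix a assume a: "a \<in> simple_orders \<alpha>"
  have "renyi_div_simple a P Q \<le> ennreal u * renyi_div_simple a P Q0 + ennreal v * renyi_div_simple a P Q1"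
    using simple_orders_range[OF a] assms by (intro renyi_div_simple_convex)
  also have "\<dots> \<le> ennreal u * renyi_div \<alpha> P Q0 + ennreal v * renyi_div \<alpha> P Q1"
    unfolding renyi_div_eq_SUP using a by (intro add_mono mult_left_mono SUP_upper) auto
  finally show "renyi_div_simple a P Q \<le> \<dots>" .
qed

section \<open>The simplex and lower semicontinuity\<close>

text \<open>Coordinates for the distributions \<open>Q\<close>, so that convexity and compactness
  are those of Euclidean space.\<close>

definition prob_simplex :: "(real ^ 'x) set" where
  "prob_simplex = {v. (\<forall>i. 0 \<le> v $ i) \<and> (\<Sum>i\<in>UNIV. v $ i) = 1}"

definition vec_pmf :: "real ^ 'x \<Rightarrow> 'x::finite pmf" where
  "vec_pmf v = embed_pmf (\<lambda>i. v $ i)"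

lemma pmf_vec_pmf:
  assumes "v \<in> prob_simplex"
  shows "pmf (vec_pmf v) i = v $ i"
  unfolding vec_pmf_def
proof (rule pmf_embed_pmf)
  show "0 \<le> v $ i" for i
    using assms by (simp add: prob_simplex_def)
  show "(\<integral>\<^sup>+ i. ennreal (v $ i) \<partial>count_space UNIV) = 1"
    using assms by (simp add: prob_simplex_def nn_integral_count_space_finite)
qed

lemma vec_pmf_image: "vec_pmf ` prob_simplex = UNIV"
proof -
  have "Q \<in> vec_pmf ` prob_simplex" for Q :: "'a pmf"
  proof
    let ?v = "\<chi> i. pmf Q i"
    show v: "?v \<in> prob_simplex"
      by (simp add: prob_simplex_def sum_pmf_UNIV)
    show "Q = vec_pmf ?v"
      by (rule pmf_eqI) (simp add: pmf_vec_pmf[OF v])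
  qed
  then show ?thesis by auto
qed

lemma convex_prob_simplex: "convex prob_simplex"
  unfolding convex_def
  by (auto simp: prob_simplex_def sum.distrib sum_distrib_left[symmetric])

lemma prob_simplex_le_1: "v \<in> prob_simplex \<Longrightarrow> v $ i \<le> 1"
  using pmf_le_1[of "vec_pmf v" i] by (simp add: pmf_vec_pmf)

lemma compact_prob_simplex: "compact (prob_simplex :: (real ^ 'x) set)"
proof -
  have "closed (prob_simplex :: (real ^ 'x) set)"
    unfolding prob_simplex_def
    by (intro closed_Collect_conj closed_Collect_all closed_Collect_le closed_Collect_eq continuous_intros)
  moreover have "prob_simplex \<subseteq> cbox 0 (1 :: real ^ 'x)"
  proof
    fix v :: "real ^ 'x"
    assume v: "v \<in> prob_simplex"
    then show "v \<in> cbox 0 1"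
      using prob_simplex_le_1[OF v] by (auto simp: mem_box_cart prob_simplex_def)
  qed
  then have "bounded (prob_simplex :: (real ^ 'x) set)"
    using bounded_cbox bounded_subset by blast
  ultimately show ?thesis
    by (simp add: compact_eq_bounded_closed)
qed

text \<open>The set is a preimage of a closed ray. Below 1 the exponent \<open>1 - a\<close> is
  positive, so the real sum is continuous up to the boundary. Above 1 the terms blow up there, but
  as maps into \<open>ennreal\<close>, where \<open>inverse 0 = \<top>\<close>, they remain
  continuous.\<close>

lemma closed_renyi_div_simple_sublevel:
  assumes a: "a \<noteq> 1" and r: "0 \<le> r"
  shows "closed {v \<in> prob_simplex. renyi_div_simple a P (vec_pmf v) \<le> ennreal r}"
proof -
  have closed: "closed (prob_simplex :: (real ^ 'b) set)"
    by (simp add: compact_imp_closed compact_prob_simplex)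
  show ?thesis
  proof (cases "a < 1")
    case True
    have "continuous_on prob_simplex (\<lambda>v. \<Sum>x\<in>UNIV. pmf P x powr a * (v $ x) powr (1 - a))"
      using True by (intro continuous_intros continuous_on_powr') (auto simp: prob_simplex_def)
    then have "continuous_on prob_simplex (\<lambda>v. hellinger_sum a P (vec_pmf v))"
      unfolding hellinger_sum_def by (rule continuous_on_eq) (simp add: pmf_vec_pmf)
    then have "closed (prob_simplex \<inter> (\<lambda>v. hellinger_sum a P (vec_pmf v)) -` {exp ((a - 1) * r)..})"
      by (intro continuous_closed_preimage closed closed_atLeast)
    moreover have "prob_simplex \<inter> (\<lambda>v. hellinger_sum a P (vec_pmf v)) -` {exp ((a - 1) * r)..} = {v \<in> prob_simplex. renyi_div_simple a P (vec_pmf v) \<le> ennreal r}"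
      using True by (auto simp: renyi_div_simple_le_iff[OF r a])
    ultimately show ?thesis
      by simp
  next
    case False
    then have "1 < a"
      using a by simp
    have "continuous_on prob_simplex
        (\<lambda>v. \<Sum>x\<in>UNIV. ennreal (pmf P x powr a) * inverse (ennreal ((v $ x) powr (a - 1))))"
      using \<open>1 < a\<close>
      by (intro continuous_on_sum ennreal_continuous_on_cmult continuous_on_inverse_ennreal
          continuous_on_ennreal continuous_on_powr' continuous_intros)
        (auto simp: prob_simplex_def)
    then have "continuous_on prob_simplex (\<lambda>v. renyi_sum a P (vec_pmf v))"
      unfolding renyi_sum_def using False
      by (elim continuous_on_eq) (simp add: pmf_vec_pmf divide_ennreal_def)
    then have "closed (prob_simplex \<inter> (\<lambda>v. renyi_sum a P (vec_pmf v)) -` {..ennreal (exp ((a - 1) * r))})"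
      by (intro continuous_closed_preimage closed closed_atMost)
    moreover have "prob_simplex \<inter> (\<lambda>v. renyi_sum a P (vec_pmf v)) -` {..ennreal (exp ((a - 1) * r))} = {v \<in> prob_simplex. renyi_div_simple a P (vec_pmf v) \<le> ennreal r}"
      using False by (auto simp: renyi_div_simple_le_iff[OF r a])
    ultimately show ?thesis
      by simp
  qed
qed

lemma closed_renyi_div_sublevel:
  assumes "0 \<le> r"
  shows "closed {v \<in> prob_simplex. renyi_div \<alpha> P (vec_pmf v) \<le> ennreal r}"
proof -
  have "closed (prob_simplex \<inter>
      (\<Inter>a\<in>simple_orders \<alpha>. {v \<in> prob_simplex. renyi_div_simple a P (vec_pmf v) \<le> ennreal r}))"
    using assms simple_orders_range
    by (intro closed_Int closed_INT ballI closed_renyi_div_simple_sublevel compact_imp_closed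
        compact_prob_simplex)
  also have "\<dots> = {v \<in> prob_simplex. renyi_div \<alpha> P (vec_pmf v) \<le> ennreal r}"
    by (auto simp: renyi_div_eq_SUP SUP_le_iff)
  finally show ?thesis .
qed

section \<open>Finitely supported priors and duality\<close>

text \<open>Only \<open>\<le>\<close> is claimed because \<open>f\<close> need not be measurable.\<close>

lemma finitely_supported_measure:
  fixes w :: "'t::topological_space \<Rightarrow> real"
  assumes closed: "\<And>i::'t. closed {i}"
    and I: "finite I" and w: "\<And>i. i \<in> I \<Longrightarrow> 0 \<le> w i" "sum w I = 1"
  obtains \<pi> :: "'t measure" where "prob_space \<pi>" "sets \<pi> = sets borel"
    "\<And>f. (\<Sum>i\<in>I. ennreal (w i) * f i) \<le> (\<integral>\<^sup>+i. f i \<partial>\<pi>)"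
proof -
  define g where "g i = (if i \<in> I then w i else 0)" for i
  define p where "p = embed_pmf g"
  have pmf_p: "pmf p i = g i" for i
    unfolding p_def
  proof (rule pmf_embed_pmf)
    show "0 \<le> g i" for i
      using w by (simp add: g_def)
    have "(\<integral>\<^sup>+ i. ennreal (g i) \<partial>count_space UNIV) = (\<Sum>i\<in>I. ennreal (g i))"
      using I by (intro nn_integral_count_space') (auto simp: g_def)
    also have "\<dots> = 1"
      using w by (simp add: g_def sum_ennreal)
    finally show "(\<integral>\<^sup>+ i. ennreal (g i) \<partial>count_space UNIV) = 1" .
  qed
  \<comment> \<open>The identity pushes the discrete measure to the Borel sets; closed points make
    each \<open>{i}\<close> Borel, so atoms keep their mass.\<close>
  define \<pi> where "\<pi> = distr (measure_pmf p) borel (\<lambda>i. i)"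
  show thesis
  proof
    show "prob_space \<pi>"
      unfolding \<pi>_def by (intro prob_space.prob_space_distr measure_pmf.prob_space_axioms) simp
    show "sets \<pi> = sets borel"
      by (simp add: \<pi>_def)
    fix f :: "'t \<Rightarrow> ennreal"
    have meas: "{i} \<in> sets \<pi>" for i
      using closed by (simp add: \<pi>_def)
    have "emeasure \<pi> {i} = ennreal (g i)" for i
      using closed by (simp add: \<pi>_def emeasure_distr emeasure_pmf_single pmf_p)
    then have "(\<Sum>i\<in>I. ennreal (w i) * f i) = (\<Sum>i\<in>I. f i * emeasure \<pi> {i})"
      by (intro sum.cong) (auto simp: g_def mult.commute)
    \<comment> \<open>The combination of singleton indicators is measurable, so its integral is
      exactly the sum; it lies below \<open>f\<close> pointwise, and monotonicity of the integral
      finishes.\<close>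
    also have "\<dots> = (\<integral>\<^sup>+j. (\<Sum>i\<in>I. f i * indicator {i} j) \<partial>\<pi>)"
      using meas by (subst nn_integral_sum) (auto simp: nn_integral_cmult_indicator)
    also have "\<dots> \<le> (\<integral>\<^sup>+j. f j \<partial>\<pi>)"
    proof (rule nn_integral_mono)
      fix j
      have "(\<Sum>i\<in>I. f i * indicator {i} j) = (\<Sum>i\<in>I. if i = j then f i else 0)"
        by (intro sum.cong) (auto simp: indicator_def)
      then show "(\<Sum>i\<in>I. f i * indicator {i} j) \<le> f j"
        using I by (simp add: sum.delta)
    qed
    finally show "(\<Sum>i\<in>I. ennreal (w i) * f i) \<le> (\<integral>\<^sup>+i. f i \<partial>\<pi>)" .
  qed
qed

lemma channel_capacity_le_minimax_redundancy: "channel_capacity \<alpha> P \<le> minimax_redundancy \<alpha> P"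
  unfolding channel_capacity_def minimax_redundancy_def
proof (intro SUP_least INF_mono)
  fix \<pi> :: "'a measure" and Q :: "'b pmf"
  assume "\<pi> \<in> {\<pi>. prob_space \<pi> \<and> sets \<pi> = sets borel}"
  then interpret prob_space \<pi>
    by simp
  have "(\<integral>\<^sup>+\<theta>. renyi_div \<alpha> (P \<theta>) Q \<partial>\<pi>) \<le> (\<integral>\<^sup>+\<theta>. (SUP \<theta>. renyi_div \<alpha> (P \<theta>) Q) \<partial>\<pi>)"
    by (intro nn_integral_mono SUP_upper) simp
  also have "\<dots> = (SUP \<theta>. renyi_div \<alpha> (P \<theta>) Q)"
    by (simp add: emeasure_space_1)
  finally show "\<exists>Q'\<in>UNIV. (\<integral>\<^sup>+\<theta>. renyi_div \<alpha> (P \<theta>) Q' \<partial>\<pi>) \<le> (SUP \<theta>. renyi_div \<alpha> (P \<theta>) Q)"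
    by blast
qed

theorem theorem34:
  fixes P :: "'t::topological_space \<Rightarrow> 'x::finite pmf" and \<alpha> :: ennreal
  assumes "\<And>\<theta>::'t. closed {\<theta>}"
    and "(\<lambda>\<theta>. measure_pmf (P \<theta>)) \<in> borel \<rightarrow>\<^sub>M prob_algebra (count_space UNIV)"
  shows "channel_capacity \<alpha> P = minimax_redundancy \<alpha> P"
proof (rule antisym[OF channel_capacity_le_minimax_redundancy dense_le])
  let ?K = "prob_simplex :: (real ^ 'x) set"
  \<comment> \<open>Levels strictly below the redundancy are finite even when the redundancy is
    \<open>\<top>\<close>, so they can be represented by a real \<open>s\<close>.\<close>
  fix s' assume s': "s' < minimax_redundancy \<alpha> P"
  define s where "s = enn2real s'"
  have s: "s' = ennreal s" "0 \<le> s"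
    using less_le_trans[OF s' top_greatest] by (auto simp: s_def)
  have "minimax_redundancy \<alpha> P = (INF v\<in>?K. SUP \<theta>. renyi_div \<alpha> (P \<theta>) (vec_pmf v))"
    unfolding minimax_redundancy_def vec_pmf_image[symmetric] image_image ..
  then have less: "ennreal s < (INF v\<in>?K. SUP \<theta>. renyi_div \<alpha> (P \<theta>) (vec_pmf v))"
    using s s' by simp
  have "?K \<noteq> {}"
    using vec_pmf_image by blast
  have conv: "renyi_div \<alpha> (P \<theta>) (vec_pmf (u *\<^sub>R x + v *\<^sub>R y)) \<le>
      ennreal u * renyi_div \<alpha> (P \<theta>) (vec_pmf x) + ennreal v * renyi_div \<alpha> (P \<theta>) (vec_pmf y)"
    if "x \<in> ?K" "y \<in> ?K" "0 < u" "0 < v" "u + v = 1" for \<theta> x y u v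
  proof -
    have "u *\<^sub>R x + v *\<^sub>R y \<in> ?K"
      using convex_prob_simplex that by (auto simp: convex_def)
    then show ?thesis
      using that by (intro renyi_div_convex) (auto simp: pmf_vec_pmf)
  qed
  obtain I w where I: "finite I" "\<forall>i\<in>I. 0 \<le> w i" "sum w I = 1"
    and w: "\<forall>v\<in>?K. ennreal s \<le> (\<Sum>i\<in>I. ennreal (w i) * renyi_div \<alpha> (P i) (vec_pmf v))"
    using compact_minimax_ennreal[OF compact_prob_simplex convex_prob_simplex \<open>?K \<noteq> {}\<close> conv
        closed_renyi_div_sublevel s(2) less]
    by blast
  obtain \<pi> :: "'t measure" where \<pi>: "prob_space \<pi>" "sets \<pi> = sets borel"
    and \<pi>_ge: "\<And>f. (\<Sum>i\<in>I. ennreal (w i) * f i) \<le> (\<integral>\<^sup>+i. f i \<partial>\<pi>)"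
    using finitely_supported_measure[OF assms(1) I(1), of w] I by auto
  have "ennreal s \<le> (INF Q. \<integral>\<^sup>+\<theta>. renyi_div \<alpha> (P \<theta>) Q \<partial>\<pi>)"
  proof (rule INF_greatest)
    fix Q :: "'x pmf"
    obtain v where "v \<in> ?K" "Q = vec_pmf v"
      using vec_pmf_image by blast
    then have "ennreal s \<le> (\<Sum>i\<in>I. ennreal (w i) * renyi_div \<alpha> (P i) Q)"
      using w by simp
    also have "\<dots> \<le> (\<integral>\<^sup>+\<theta>. renyi_div \<alpha> (P \<theta>) Q \<partial>\<pi>)"
      by (rule \<pi>_ge)
    finally show "ennreal s \<le> (\<integral>\<^sup>+\<theta>. renyi_div \<alpha> (P \<theta>) Q \<partial>\<pi>)" .
  qed
  also have "\<dots> \<le> channel_capacity \<alpha> P"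
    unfolding channel_capacity_def using \<pi> by (intro SUP_upper) simp
  finally show "s' \<le> channel_capacity \<alpha> P"
    by (simp add: s)
qed

end
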